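(* Let $\mathbb S_0,\mathbb S_1,\mathbb S_2,\dots$ be finite pairwise disjoint sets with $\mathbb S_0=\{\varnothing\}$ a singleton. Let $(p^\uparrow_n)_{n\ge 0}$ and $(p^\downarrow_n)_{n\ge 1}$ be transition (stochastic) matrices, $p^\uparrow_n$ from $\mathbb S_n$ to $\mathbb S_{n+1}$ and $p^\downarrow_n$ from $\mathbb S_n$ to $\mathbb S_{n-1}$, and suppose there are constants $\beta_1,\beta_2,\dots\in(0,1)$ with $$p^\uparrow_n p^\downarrow_{n+1}=\beta_n\,p^\downarrow_n p^\uparrow_{n-1}+(1-\beta_n)\,i_n,\qquad n\ge 1,$$ where $i_n$ is the $|\mathbb S_n|\times|\mathbb S_n|$ identity matrix. Let $X_n$ be the Markov chain on $\mathbb S_n$ with transition matrix $p_n=p^\uparrow_np^\downarrow_{n+1}$ and $T_n$ its transition operator on $C(\mathbb S_n)$. Put $c_{-1}=0$, $c_k=\beta_1^{-1}\cdots\beta_k^{-1}$ for $k\ge 0$. Let $(h_s)_{s\in\mathbb S}$ be the explicit family of functions on $\mathbb S=\bigcup_n\mathbb S_n$ defined in the context, and write $(f)_n$ for the restriction of $f$ to $\mathbb S_n$. Then: 1. For all $0\le k\le n$ and $s\in\mathbb S_k$, $$c_n(T_n-I)(h_s)_n=-c_{k-1}(h_s)_n;$$ for all $n\ge 0$, $C(\mathbb S_n)=\operatorname{span}\{(h_s)_n: s\in\bigcup_{k=0}^n\mathbb S_k\}$; and $$\dim\operatorname{span}\{(h_s)_n\}_{s\in\mathbb S_k}=\begin{cases}|\mathbb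 S_k|-|\mathbb S_{k-1}|,&1\le k\le n,\\ 1,&k=0.\end{cases}$$ 2. Each chain $X_n$ is ergodic, and its unique stationary distribution is $$M_n(s)=(p^\uparrow_0p^\uparrow_1\cdots p^\uparrow_{n-1})(\varnothing,s),\qquad s\in\mathbb S_n.$$
   Context: $C(\mathbb S_n)$ is the space of all real functions on the finite set $\mathbb S_n$; $(T_nf)(r)=\sum_{s}p_n(r,s)f(s)$; $I$ is the identity. A Markov chain is called ergodic if it converges in distribution to a unique stationary distribution for any initial state. For $s\in\mathbb S$, $|s|$ denotes the index $n$ with $s\in\mathbb S_n$. Definition of $h_s$. For $0\le k\le n$ let $p^\uparrow_{k,n}=p^\uparrow_kp^\uparrow_{k+1}\cdots p^\uparrow_{n-1}$ and $p^\downarrow_{n,k}=p^\downarrow_np^\downarrow_{n-1}\cdots p^\downarrow_{k+1}$ (identity matrices if $k=n$). For $s,u\in\mathbb S$ put $d_s(u)=p^\downarrow_{|u|,|s|}(u,s)$ if $|u|\ge|s|$ and $d_s(u)=0$ otherwise. For $0\le i\le j$ put $\eta_{i,j}=\prod_{m=i}^{j-1}\frac{c_m}{c_{m-1}-c_{j-1}}$ (empty product $=1$). Then $$h_s=\sum_{r\in\mathbb S,\ |r|\le|s|}p^\uparrow_{|r|,|s|}(r,s)\,\eta_{|r|,|s|}\,d_r.$$ *)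

theory Defs
  imports Complex_Main "HOL-Library.Function_Algebras" "HOL-Library.Disjoint_Sets"
begin

text \<open>
  A matrix with rows indexed by \<open>A\<close> and columns indexed by \<open>B\<close> is a function
  \<open>'a \<Rightarrow> 'a \<Rightarrow> real\<close> of which only the values on \<open>A \<times> B\<close> are meaningful.
\<close>

definition stochastic :: "'a set \<Rightarrow> 'a set \<Rightarrow> ('a \<Rightarrow> 'a \<Rightarrow> real) \<Rightarrow> bool" where
  "stochastic A B P \<longleftrightarrow> (\<forall>r\<in>A. (\<forall>s\<in>B. 0 \<le> P r s) \<and> (\<Sum>s\<in>B. P r s) = 1)"

definition mat_id :: "'a \<Rightarrow> 'a \<Rightarrow> real" where
  "mat_id r s = (if r = s then 1 else 0)"

text \<open>The first argument of \<open>mat_mult\<close> is the index set that is summed over.\<close>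

definition mat_mult :: "'a set \<Rightarrow> ('a \<Rightarrow> 'a \<Rightarrow> real) \<Rightarrow> ('a \<Rightarrow> 'a \<Rightarrow> real) \<Rightarrow> 'a \<Rightarrow> 'a \<Rightarrow> real" where
  "mat_mult B P Q r s = (\<Sum>u\<in>B. P r u * Q u s)"

text \<open>
  For \<open>k \<le> n\<close>, \<open>up_prod S pu k n\<close> is the product \<open>pu k \<cdot> pu (k+1) \<cdots> pu (n-1)\<close> and
  \<open>down_prod S pd n k\<close> is the product \<open>pd n \<cdot> pd (n-1) \<cdots> pd (k+1)\<close>.  Their values for
  \<open>n < k\<close> are irrelevant.
\<close>

primrec up_prod :: "(nat \<Rightarrow> 'a set) \<Rightarrow> (nat \<Rightarrow> 'a \<Rightarrow> 'a \<Rightarrow> real) \<Rightarrow> nat \<Rightarrow> nat \<Rightarrow> 'a \<Rightarrow> 'a \<Rightarrow> real" where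
  "up_prod S pu k 0 = mat_id"
| "up_prod S pu k (Suc n) =
     (if Suc n \<le> k then mat_id else mat_mult (S n) (up_prod S pu k n) (pu n))"

primrec down_prod :: "(nat \<Rightarrow> 'a set) \<Rightarrow> (nat \<Rightarrow> 'a \<Rightarrow> 'a \<Rightarrow> real) \<Rightarrow> nat \<Rightarrow> nat \<Rightarrow> 'a \<Rightarrow> 'a \<Rightarrow> real" where
  "down_prod S pd 0 k = mat_id"
| "down_prod S pd (Suc n) k =
     (if Suc n \<le> k then mat_id else mat_mult (S n) (pd (Suc n)) (down_prod S pd n k))"

definition chain_mat ::
  "(nat \<Rightarrow> 'a set) \<Rightarrow> (nat \<Rightarrow> 'a \<Rightarrow> 'a \<Rightarrow> real) \<Rightarrow> (nat \<Rightarrow> 'a \<Rightarrow> 'a \<Rightarrow> real) \<Rightarrow> nat \<Rightarrow> 'a \<Rightarrow> 'a \<Rightarrow> real" where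
  "chain_mat S pu pd n = mat_mult (S (Suc n)) (pu n) (pd (Suc n))"

text \<open>Meaningful for \<open>s \<in> (\<Union>n. S n)\<close>, when the sets \<open>S n\<close> are pairwise disjoint.\<close>

definition level :: "(nat \<Rightarrow> 'a set) \<Rightarrow> 'a \<Rightarrow> nat" where
  "level S s = (THE n. s \<in> S n)"

definition d_fun :: "(nat \<Rightarrow> 'a set) \<Rightarrow> (nat \<Rightarrow> 'a \<Rightarrow> 'a \<Rightarrow> real) \<Rightarrow> 'a \<Rightarrow> 'a \<Rightarrow> real" where
  "d_fun S pd s u =
     (if level S s \<le> level S u then down_prod S pd (level S u) (level S s) u s else 0)"

text \<open>The index is an integer because \<open>c_coeff \<beta> (-1)\<close> occurs.\<close>

definition c_coeff :: "(nat \<Rightarrow> real) \<Rightarrow> int \<Rightarrow> real" where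
  "c_coeff \<beta> k = (if k < 0 then 0 else \<Prod>i=1..nat k. inverse (\<beta> i))"

definition eta :: "(nat \<Rightarrow> real) \<Rightarrow> nat \<Rightarrow> nat \<Rightarrow> real" where
  "eta \<beta> i j =
     (\<Prod>m=i..<j. c_coeff \<beta> (int m) / (c_coeff \<beta> (int m - 1) - c_coeff \<beta> (int j - 1)))"

definition h_fun ::
  "(nat \<Rightarrow> 'a set) \<Rightarrow> (nat \<Rightarrow> 'a \<Rightarrow> 'a \<Rightarrow> real) \<Rightarrow> (nat \<Rightarrow> 'a \<Rightarrow> 'a \<Rightarrow> real) \<Rightarrow> (nat \<Rightarrow> real)
     \<Rightarrow> 'a \<Rightarrow> 'a \<Rightarrow> real" where
  "h_fun S pu pd \<beta> s u =
     (\<Sum>r\<in>{r \<in> (\<Union>n. S n). level S r \<le> level S s}.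
        up_prod S pu (level S r) (level S s) r s * eta \<beta> (level S r) (level S s) * d_fun S pd r u)"

text \<open>
  A real function on the finite set \<open>A\<close> is represented by its extension by zero to the whole
  type.  In this way \<open>fun_space A\<close> is a linear subspace of \<open>'a \<Rightarrow> real\<close>, on which \<open>fun_vs.span\<close>
  and \<open>fun_vs.dim\<close> are the usual linear-algebra notions.
\<close>

definition fun_scale :: "real \<Rightarrow> ('a \<Rightarrow> real) \<Rightarrow> 'a \<Rightarrow> real" where
  "fun_scale a f = (\<lambda>x. a * f x)"

interpretation fun_vs: vector_space "fun_scale :: real \<Rightarrow> ('a \<Rightarrow> real) \<Rightarrow> 'a \<Rightarrow> real"
  by unfold_locales (auto simp: fun_scale_def algebra_simps)

definition fun_space :: "'a set \<Rightarrow> ('a \<Rightarrow> real) set" where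
  "fun_space A = {f. \<forall>x. x \<notin> A \<longrightarrow> f x = 0}"

definition restr :: "'a set \<Rightarrow> ('a \<Rightarrow> real) \<Rightarrow> 'a \<Rightarrow> real" where
  "restr A f = (\<lambda>x. if x \<in> A then f x else 0)"

definition transition_op :: "'a set \<Rightarrow> ('a \<Rightarrow> 'a \<Rightarrow> real) \<Rightarrow> ('a \<Rightarrow> real) \<Rightarrow> 'a \<Rightarrow> real" where
  "transition_op A P f = restr A (\<lambda>r. \<Sum>s\<in>A. P r s * f s)"

text \<open>
  \<open>chain_law A P r t s\<close> is the probability that the Markov chain on \<open>A\<close> with transition
  matrix \<open>P\<close> started at \<open>r\<close> is at \<open>s\<close> at time \<open>t\<close>.
\<close>

primrec chain_law :: "'a set \<Rightarrow> ('a \<Rightarrow> 'a \<Rightarrow> real) \<Rightarrow> 'a \<Rightarrow> nat \<Rightarrow> 'a \<Rightarrow> real" where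
  "chain_law A P r 0 = (\<lambda>s. if s = r then 1 else 0)"
| "chain_law A P r (Suc t) = (\<lambda>s. \<Sum>u\<in>A. chain_law A P r t u * P u s)"

definition stationary_distribution :: "'a set \<Rightarrow> ('a \<Rightarrow> 'a \<Rightarrow> real) \<Rightarrow> ('a \<Rightarrow> real) \<Rightarrow> bool" where
  "stationary_distribution A P \<pi> \<longleftrightarrow>
     (\<forall>s\<in>A. 0 \<le> \<pi> s) \<and> (\<Sum>s\<in>A. \<pi> s) = 1 \<and> (\<forall>s\<in>A. (\<Sum>r\<in>A. \<pi> r * P r s) = \<pi> s)"

definition unique_stationary_distribution ::
  "'a set \<Rightarrow> ('a \<Rightarrow> 'a \<Rightarrow> real) \<Rightarrow> ('a \<Rightarrow> real) \<Rightarrow> bool" where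
  "unique_stationary_distribution A P \<pi> \<longleftrightarrow>
     stationary_distribution A P \<pi> \<and>
     (\<forall>\<nu>. stationary_distribution A P \<nu> \<longrightarrow> (\<forall>s\<in>A. \<nu> s = \<pi> s))"

text \<open>
  Convergence in distribution, tested against bounded continuous functions: on a finite discrete
  space these are all real functions.
\<close>

definition converges_in_distribution :: "'a set \<Rightarrow> (nat \<Rightarrow> 'a \<Rightarrow> real) \<Rightarrow> ('a \<Rightarrow> real) \<Rightarrow> bool" where
  "converges_in_distribution A \<mu> \<pi> \<longleftrightarrow>
     (\<forall>f :: 'a \<Rightarrow> real. (\<lambda>t. \<Sum>s\<in>A. \<mu> t s * f s) \<longlonglongrightarrow> (\<Sum>s\<in>A. \<pi> s * f s))"

definition ergodic :: "'a set \<Rightarrow> ('a \<Rightarrow> 'a \<Rightarrow> real) \<Rightarrow> bool" where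
  "ergodic A P \<longleftrightarrow>
     (\<exists>\<pi>. unique_stationary_distribution A P \<pi> \<and>
          (\<forall>r\<in>A. converges_in_distribution A (chain_law A P r) \<pi>))"

end

theory Submission
  imports Defs
begin

text \<open>
  Let \<open>U\<close> and \<open>D\<close> be the operators of the up and down matrices.  The commutation relation reads
  \<open>T = \<beta> D U + (1 - \<beta>)\<close> with \<open>T = U D\<close>, so the operators \<open>c\<^sub>n (T\<^sub>n - I)\<close> intertwine with both \<open>D\<close>
  and \<open>U\<close>.  On the kernel of \<open>U\<close> from level \<open>k\<close> to level \<open>k - 1\<close> the operator \<open>c\<^sub>k (T\<^sub>k - I)\<close> is
  \<open>- c\<^sub>k\<^sub>-\<^sub>1\<close>, and this eigenvalue is transported to every level \<open>n \<ge> k\<close> by the down products.  The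
  coefficients \<open>\<eta>\<close> are exactly those for which the operator \<open>P\<^sub>k = \<Sum>\<^sub>i \<eta>\<^sub>i\<^sub>k D\<^sub>k\<^sub>i U\<^sub>i\<^sub>k\<close> is a projection onto
  that kernel with \<open>P\<^sub>k - I\<close> factoring through \<open>D\<close>, and \<open>h\<^sub>s\<close> is the transport of \<open>P\<^sub>k \<delta>\<^sub>s\<close>.  Hence
  \<open>C(S\<^sub>k) = ker U \<oplus> D C(S\<^sub>k\<^sub>-\<^sub>1)\<close>, which gives the spanning property by induction, and the dimensions
  because \<open>D\<close> is injective (0 is not an eigenvalue of \<open>T\<close>).  All eigenvalues of \<open>T\<^sub>n\<close> other than the
  one on the constants lie in \<open>[0, 1)\<close>, whence ergodicity.
\<close>

section \<open>Matrices acting on functions\<close>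

text \<open>Extending by zero off \<open>A\<close> turns operator identities into equalities of
  functions on the whole type and puts every value in \<open>fun_space A\<close>.\<close>

definition mat_op :: "'a set \<Rightarrow> 'a set \<Rightarrow> ('a \<Rightarrow> 'a \<Rightarrow> real) \<Rightarrow> ('a \<Rightarrow> real) \<Rightarrow> 'a \<Rightarrow> real" where
  "mat_op A B P f = restr A (\<lambda>r. \<Sum>s\<in>B. P r s * f s)"

lemma sum_fun_apply: "(\<Sum>i\<in>I. f i) x = (\<Sum>i\<in>I. f i x)"
  for f :: "'i \<Rightarrow> 'a \<Rightarrow> real"
  by (induction I rule: infinite_finite_induct) auto

lemma transition_op_eq_mat_op: "transition_op A P = mat_op A A P"
  by (auto simp: transition_op_def mat_op_def)

lemma restr_in_fun_space: "restr A f \<in> fun_space A"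
  by (auto simp: restr_def fun_space_def)

lemma mat_op_in_fun_space: "mat_op A B P f \<in> fun_space A"
  by (simp add: mat_op_def restr_in_fun_space)

lemma mat_op_apply: "r \<in> A \<Longrightarrow> mat_op A B P f r = (\<Sum>s\<in>B. P r s * f s)"
  by (simp add: mat_op_def restr_def)

lemma linear_mat_op: "Vector_Spaces.linear fun_scale fun_scale (mat_op A B P)"
proof
  show "mat_op A B P (f + g) = mat_op A B P f + mat_op A B P g" for f g
    by (rule ext) (auto simp: mat_op_def restr_def algebra_simps sum.distrib)
  show "mat_op A B P (fun_scale a f) = fun_scale a (mat_op A B P f)" for a f
    by (rule ext) (auto simp: mat_op_def restr_def fun_scale_def sum_distrib_left mult_ac)
qed

interpretation mat_op: Vector_Spaces.linear fun_scale fun_scale "mat_op A B P" for A B P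
  by (rule linear_mat_op)

lemma mat_op_comp:
  assumes "finite B"
  shows "mat_op A C (mat_mult B P Q) f = mat_op A B P (mat_op B C Q f)"
proof
  fix r
  have "(\<Sum>s\<in>C. (\<Sum>u\<in>B. P r u * Q u s) * f s) = (\<Sum>u\<in>B. P r u * (\<Sum>s\<in>C. Q u s * f s))"
    unfolding sum_distrib_left sum_distrib_right by (subst sum.swap) (simp add: mult_ac)
  then show "mat_op A C (mat_mult B P Q) f r = mat_op A B P (mat_op B C Q f) r"
    by (simp add: mat_op_def restr_def mat_mult_def)
qed

lemma mat_op_mat_id:
  assumes "finite A" "f \<in> fun_space A"
  shows "mat_op A A mat_id f = f"
proof
  fix r
  have "(\<Sum>s\<in>A. mat_id r s * f s) = f r" if "r \<in> A"
  proof -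
    have "(\<Sum>s\<in>A. mat_id r s * f s) = (\<Sum>s\<in>A. if s = r then f s else 0)"
      by (intro sum.cong) (auto simp: mat_id_def)
    then show ?thesis
      using that assms(1) by simp
  qed
  then show "mat_op A A mat_id f r = f r"
    using assms(2) by (auto simp: mat_op_def restr_def fun_space_def)
qed

section \<open>Point masses \<open>mat_id s\<close> as a basis of the function space\<close>

lemma mat_id_in_fun_space: "s \<in> A \<Longrightarrow> mat_id s \<in> fun_space A"
  by (auto simp: mat_id_def fun_space_def)

lemma sum_mat_id_right:
  assumes "finite B" "s \<in> B"
  shows "(\<Sum>t\<in>B. f t * mat_id s t) = f s"
proof -
  have "(\<Sum>t\<in>B. f t * mat_id s t) = (\<Sum>t\<in>B. if t = s then f t else 0)"
    by (intro sum.cong) (auto simp: mat_id_def)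
  with assms show ?thesis by simp
qed

lemma subspace_fun_space: "fun_vs.subspace (fun_space A)"
  by (auto simp: fun_vs.subspace_def fun_space_def fun_scale_def)

lemma fun_space_expand:
  assumes "finite A" "f \<in> fun_space A"
  shows "f = (\<Sum>s\<in>A. fun_scale (f s) (mat_id s))"
proof
  fix x
  have "(\<Sum>s\<in>A. f s * mat_id s x) = (\<Sum>s\<in>A. if s = x then f s else 0)"
    by (intro sum.cong) (auto simp: mat_id_def)
  also have "\<dots> = f x"
    using assms by (auto simp: fun_space_def)
  finally show "f x = (\<Sum>s\<in>A. fun_scale (f s) (mat_id s)) x"
    by (simp add: sum_fun_apply fun_scale_def)
qed

lemma span_mat_id:
  assumes "finite A"
  shows "fun_vs.span (mat_id ` A) = fun_space A"
proof (rule fun_vs.span_subspace)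
  show "mat_id ` A \<subseteq> fun_space A"
    by (auto intro: mat_id_in_fun_space)
  show "fun_space A \<subseteq> fun_vs.span (mat_id ` A)"
  proof
    fix f :: "'a \<Rightarrow> real"
    assume "f \<in> fun_space A"
    then have "f = (\<Sum>s\<in>A. fun_scale (f s) (mat_id s))"
      using assms by (rule fun_space_expand[rotated])
    then show "f \<in> fun_vs.span (mat_id ` A)"
      by (metis (no_types, lifting) fun_vs.span_sum fun_vs.span_scale fun_vs.span_base imageI)
  qed
qed (rule subspace_fun_space)

lemma inj_mat_id: "inj mat_id"
  by (auto simp: inj_def mat_id_def fun_eq_iff)

lemma independent_mat_id:
  assumes "finite A"
  shows "fun_vs.independent (mat_id ` A)"
proof (rule fun_vs.independent_if_scalars_zero)
  show "finite (mat_id ` A)" using assms by simp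
  fix a x
  assume 0: "(\<Sum>v\<in>mat_id ` A. fun_scale (a v) v) = 0" and "x \<in> mat_id ` A"
  then obtain s where s: "s \<in> A" "x = mat_id s" by auto
  have "(\<Sum>t\<in>A. fun_scale (a (mat_id t)) (mat_id t)) s = 0"
    using 0 by (subst (asm) sum.reindex) (auto intro: inj_on_subset[OF inj_mat_id])
  moreover have "(\<Sum>t\<in>A. fun_scale (a (mat_id t)) (mat_id t)) s = (\<Sum>t\<in>A. if t = s then a (mat_id t) else 0)"
    unfolding sum_fun_apply by (intro sum.cong) (auto simp: mat_id_def fun_scale_def)
  ultimately show "a x = 0"
    using s assms by simp
qed

lemma card_mat_id_image: "card (mat_id ` A) = card A"
  by (intro card_image inj_on_subset[OF inj_mat_id]) auto

lemma dim_fun_space: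
  assumes "finite A"
  shows "fun_vs.dim (fun_space A) = card A"
  using fun_vs.dim_span_eq_card_independent[OF independent_mat_id[OF assms]]
  by (simp add: span_mat_id[OF assms] card_mat_id_image)

section \<open>Dimensions of direct sums and of injective images\<close>

lemma (in vector_space) independent_Un_direct:
  assumes "finite B" "independent A" "independent B" "span A \<inter> span B \<subseteq> {0}"
  shows "independent (A \<union> B)"
  using assms
proof (induction B rule: finite_induct)
  case (insert b B)
  have sub: "span B \<subseteq> span (insert b B)"
    by (intro span_mono) auto
  have indep: "independent B" "b \<notin> span B"
    using insert.prems(2) insert.hyps(2) by (auto simp: independent_insert)
  have "b \<notin> span (A \<union> B)"
  proof
    assume "b \<in> span (A \<union> B)"
    then obtain x y where xy: "b = x + y" "x \<in> span A" "y \<in> span B"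
      by (auto simp: span_Un)
    \<comment> \<open>Here \<open>b - y = x\<close> lies in both spans, so \<open>x = 0\<close> and
      \<open>b\<close> would already lie in \<open>span B\<close>.\<close>
    have "b - y \<in> span (insert b B)"
      using xy(3) sub by (blast intro: span_diff span_base)
    then have "x = 0"
      using xy insert.prems(3) by auto
    with xy indep show False by simp
  qed
  moreover have "independent (A \<union> B)"
    using insert.IH insert.prems indep sub by blast
  ultimately show ?case
    by (simp add: independent_insertI)
qed auto

lemma (in vector_space) dim_direct_sum:
  assumes "finite A" "finite B" "independent A" "independent B" "span A \<inter> span B \<subseteq> {0}"
  shows "dim (span (A \<union> B)) = card A + card B"
proof -
  have "A \<inter> B \<subseteq> {0}"
    using assms(5) span_superset[of A] span_superset[of B] by blast
  moreover have "0 \<notin> A"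
    using assms(3) dependent_zero by blast
  ultimately have "A \<inter> B = {}" by blast
  with assms show ?thesis
    by (simp add: dim_span_eq_card_independent[OF independent_Un_direct] card_Un_disjoint
        del: dim_span)
qed

text \<open>A basis of \<open>V\<close> is carried to a basis of the image. Injectivity is asked on
  \<open>V\<close> only, as \<open>mat_op A B P\<close> ignores values off \<open>B\<close>.\<close>

lemma (in Vector_Spaces.linear) dim_image_inj:
  assumes "vs1.subspace V" "\<And>x. x \<in> V \<Longrightarrow> f x = 0 \<Longrightarrow> x = 0"
  shows "vs2.dim (f ` V) = vs1.dim V"
proof -
  obtain B where B: "B \<subseteq> V" "vs1.independent B" "V \<subseteq> vs1.span B"
    using vs1.maximal_independent_subset[of V] by blast
  then have span: "vs1.span B = V"
    using assms(1) by (intro vs1.span_subspace)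
  have inj: "inj_on f V"
    using assms by (auto simp: inj_on_def) (metis diff vs1.subspace_diff right_minus_eq)
  have "vs2.dim (f ` V) = vs2.dim (vs2.span (f ` B))"
    by (simp only: span_image span)
  also have "\<dots> = card (f ` B)"
    using inj B by (intro vs2.dim_span_eq_card_independent independent_injective_image) (simp_all add: span)
  also have "\<dots> = card B"
    using inj B by (intro card_image) (auto intro: inj_on_subset)
  also have "\<dots> = vs1.dim V"
    using B by (intro vs1.basis_card_eq_dim)
  finally show ?thesis .
qed


text \<open>Duality between laws and test functions. The induction generalizes \<open>f\<close>
  because the last step of the chain is absorbed into it.\<close>

lemma sum_chain_law:
  assumes "finite A" "r \<in> A"
  shows "(\<Sum>s\<in>A. chain_law A P r t s * f s) = (mat_op A A P ^^ t) f r"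
proof (induction t arbitrary: f)
  case 0
  have "(\<Sum>s\<in>A. chain_law A P r 0 s * f s) = (\<Sum>s\<in>A. if s = r then f s else 0)"
    by (intro sum.cong) auto
  with assms show ?case by simp
next
  case (Suc t)
  have "(\<Sum>s\<in>A. chain_law A P r (Suc t) s * f s) = (\<Sum>u\<in>A. \<Sum>s\<in>A. chain_law A P r t u * P u s * f s)"
    unfolding chain_law.simps sum_distrib_right by (rule sum.swap)
  also have "\<dots> = (\<Sum>u\<in>A. chain_law A P r t u * mat_op A A P f u)"
    by (intro sum.cong) (simp_all add: mat_op_apply sum_distrib_left mult.assoc)
  finally show ?case
    by (simp add: Suc.IH funpow_swap1)
qed

section \<open>Up and down operators\<close>

text \<open>Indices are shifted by \<open>Suc\<close>, so that the side conditions
  \<open>n \<ge> 1\<close> disappear.\<close>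

locale up_down_chain =
  fixes S :: "nat \<Rightarrow> 'a set" and e :: 'a
    and pu pd :: "nat \<Rightarrow> 'a \<Rightarrow> 'a \<Rightarrow> real" and \<beta> :: "nat \<Rightarrow> real"
  assumes finite_S: "finite (S n)"
    and disjoint_S: "disjoint_family S"
    and S_0: "S 0 = {e}"
    and stochastic_up: "stochastic (S n) (S (Suc n)) (pu n)"
    and stochastic_down: "stochastic (S (Suc n)) (S n) (pd (Suc n))"
    and \<beta>_bounds: "0 < \<beta> (Suc n)" "\<beta> (Suc n) < 1"
    and commutation: "r \<in> S (Suc n) \<Longrightarrow> s \<in> S (Suc n) \<Longrightarrow>
      mat_mult (S (Suc (Suc n))) (pu (Suc n)) (pd (Suc (Suc n))) r s =
        \<beta> (Suc n) * mat_mult (S n) (pd (Suc n)) (pu n) r s + (1 - \<beta> (Suc n)) * mat_id r s"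
begin

abbreviation U :: "nat \<Rightarrow> ('a \<Rightarrow> real) \<Rightarrow> 'a \<Rightarrow> real" where
  "U n \<equiv> mat_op (S n) (S (Suc n)) (pu n)"

abbreviation D :: "nat \<Rightarrow> ('a \<Rightarrow> real) \<Rightarrow> 'a \<Rightarrow> real" where
  "D n \<equiv> mat_op (S (Suc n)) (S n) (pd (Suc n))"

abbreviation UU :: "nat \<Rightarrow> nat \<Rightarrow> ('a \<Rightarrow> real) \<Rightarrow> 'a \<Rightarrow> real" where
  "UU k n \<equiv> mat_op (S k) (S n) (up_prod S pu k n)"

abbreviation DD :: "nat \<Rightarrow> nat \<Rightarrow> ('a \<Rightarrow> real) \<Rightarrow> 'a \<Rightarrow> real" where
  "DD n k \<equiv> mat_op (S n) (S k) (down_prod S pd n k)"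

abbreviation T :: "nat \<Rightarrow> ('a \<Rightarrow> real) \<Rightarrow> 'a \<Rightarrow> real" where
  "T n \<equiv> mat_op (S n) (S n) (chain_mat S pu pd n)"

text \<open>The index is shifted: \<open>c k\<close> is the paper's \<open>c\<^sub>k\<^sub>-\<^sub>1\<close>, so that \<open>c 0 = 0\<close> and \<open>c 1 = 1\<close>.\<close>

definition c :: "nat \<Rightarrow> real" where
  "c k = c_coeff \<beta> (int k - 1)"

lemma c_0: "c 0 = 0"
  by (simp add: c_def c_coeff_def)

lemma c_1: "c (Suc 0) = 1"
  by (simp add: c_def c_coeff_def)

lemma c_pos: "0 < c (Suc n)"
  by (auto simp: c_def c_coeff_def intro!: prod_pos) (metis \<beta>_bounds(1) Suc_le_D One_nat_def)

text \<open>Without the shift this is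
  \<open>\<beta>\<^sub>n c\<^sub>n = c\<^sub>n\<^sub>-\<^sub>1\<close>; it turns the
  \<open>\<beta>\<close> of the commutation relation into a quotient of consecutive
  \<open>c\<close>.\<close>

lemma c_rec: "\<beta> (Suc n) * c (Suc (Suc n)) = c (Suc n)"
proof -
  have "nat (1 + int n) = Suc n" by simp
  then show ?thesis
    using \<beta>_bounds(1)[of n] by (simp add: c_def c_coeff_def)
qed

lemma c_less_Suc: "c n < c (Suc n)"
proof (cases n)
  case (Suc m)
  have "\<beta> (Suc m) * c (Suc (Suc m)) < 1 * c (Suc (Suc m))"
    using \<beta>_bounds(2) c_pos by (intro mult_strict_right_mono)
  then show ?thesis
    by (simp only: c_rec Suc mult_1)
qed (simp add: c_0 c_1)

lemma c_mono: "k < n \<Longrightarrow> c k < c n"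
  using lift_Suc_mono_less[of c] c_less_Suc by blast

section \<open>Transition operators and their intertwining relations\<close>

lemma T_eq: "T n f = U n (D n f)"
  unfolding chain_mat_def by (rule mat_op_comp) (rule finite_S)

text \<open>Down from level 1 every row has its single entry equal to 1. This starts the inductions,
  as the commutation relation begins at level 1.\<close>

lemma T_0:
  assumes "f \<in> fun_space (S 0)"
  shows "T 0 f = f"
proof
  fix x
  have "(\<Sum>u\<in>S (Suc 0). pu 0 e u * pd (Suc 0) u e) = (\<Sum>u\<in>S (Suc 0). pu 0 e u)"
    using stochastic_down[of 0] by (intro sum.cong) (auto simp: stochastic_def S_0)
  also have "\<dots> = 1"
    using stochastic_up[of 0] by (auto simp: stochastic_def S_0)
  finally have "chain_mat S pu pd 0 e e = 1"
    by (simp add: chain_mat_def mat_mult_def)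
  then show "T 0 f x = f x"
    using assms by (auto simp: mat_op_def restr_def S_0 fun_space_def)
qed

lemma T_Suc:
  assumes "f \<in> fun_space (S (Suc n))"
  shows "T (Suc n) f = fun_scale (\<beta> (Suc n)) (D n (U n f)) + fun_scale (1 - \<beta> (Suc n)) f"
proof
  fix x
  show "T (Suc n) f x = (fun_scale (\<beta> (Suc n)) (D n (U n f)) + fun_scale (1 - \<beta> (Suc n)) f) x"
  proof (cases "x \<in> S (Suc n)")
    case True
    have "T (Suc n) f x = (\<Sum>s\<in>S (Suc n).
        (\<beta> (Suc n) * mat_mult (S n) (pd (Suc n)) (pu n) x s + (1 - \<beta> (Suc n)) * mat_id x s) * f s)"
      using True by (simp add: mat_op_apply chain_mat_def commutation)
    also have "\<dots> = \<beta> (Suc n) * mat_op (S (Suc n)) (S (Suc n)) (mat_mult (S n) (pd (Suc n)) (pu n)) f x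
        + (1 - \<beta> (Suc n)) * mat_op (S (Suc n)) (S (Suc n)) mat_id f x"
      using True by (simp add: mat_op_apply algebra_simps sum.distrib sum_distrib_left sum_subtractf)
    also have "\<dots> = \<beta> (Suc n) * D n (U n f) x + (1 - \<beta> (Suc n)) * f x"
      by (simp only: mat_op_comp[OF finite_S] mat_op_mat_id[OF finite_S assms])
    finally show ?thesis
      by (simp add: fun_scale_def)
  qed (use assms in \<open>auto simp: mat_op_def restr_def fun_scale_def fun_space_def\<close>)
qed

text \<open>Follows from \<open>U D = T\<close>. By \<open>c_rec\<close> it makes
  \<open>c\<^sub>n (T\<^sub>n - I)\<close> intertwine with \<open>D\<close>; \<open>U_T\<close> is
  the mirror image.\<close>

lemma T_D: "T (Suc n) (D n f) = D n (fun_scale (\<beta> (Suc n)) (T n f) + fun_scale (1 - \<beta> (Suc n)) f)"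
  by (simp add: T_Suc mat_op_in_fun_space T_eq[of n] mat_op.add mat_op.scale)

lemma U_T:
  assumes "f \<in> fun_space (S (Suc n))"
  shows "U n (T (Suc n) f) = fun_scale (\<beta> (Suc n)) (T n (U n f)) + fun_scale (1 - \<beta> (Suc n)) (U n f)"
  by (simp add: T_Suc[OF assms] T_eq[of n] mat_op.add mat_op.scale)

lemma UU_self: "f \<in> fun_space (S n) \<Longrightarrow> UU n n f = f"
  by (cases n) (simp_all add: mat_op_mat_id finite_S)

lemma DD_self: "f \<in> fun_space (S n) \<Longrightarrow> DD n n f = f"
  by (cases n) (simp_all add: mat_op_mat_id finite_S)

lemma UU_Suc: "k \<le> n \<Longrightarrow> UU k (Suc n) f = UU k n (U n f)"
  by (simp add: mat_op_comp finite_S)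

lemma DD_Suc: "k \<le> n \<Longrightarrow> DD (Suc n) k f = D n (DD n k f)"
  by (simp add: mat_op_comp finite_S)

text \<open>Since \<open>up_prod\<close> grows at its right end, a new factor at the left end needs
  an induction on the upper level.\<close>

lemma U_UU:
  assumes "k \<le> n" "f \<in> fun_space (S (Suc n))"
  shows "U k (UU (Suc k) (Suc n) f) = UU k (Suc n) f"
  using assms
proof (induction n arbitrary: f rule: dec_induct)
  case base
  then show ?case by (simp add: UU_Suc UU_self mat_op_in_fun_space del: up_prod.simps)
next
  case (step n)
  then show ?case by (simp add: UU_Suc mat_op_in_fun_space del: up_prod.simps)
qed

text \<open>The base case is \<open>T_Suc\<close> at level \<open>i\<close>, or \<open>T_0\<close>;
  each further level applies \<open>T_D\<close>. For \<open>i = 0\<close> the truncated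
  \<open>i - 1\<close> is harmless because \<open>c 0 = 0\<close>.\<close>

lemma T_DD:
  assumes "i \<le> n" "f \<in> fun_space (S i)"
  shows "T n (DD n i f) = fun_scale (1 - c i / c (Suc n)) (DD n i f)
    + fun_scale (c i / c (Suc n)) (DD n (i - 1) (U (i - 1) f))"
  using assms
proof (induction n rule: dec_induct)
  case base
  show ?case
  proof (cases i)
    case 0
    then show ?thesis
      using base by (simp add: c_0 T_0 DD_self del: down_prod.simps)
  next
    case (Suc j)
    have "c (Suc j) / c (Suc (Suc j)) = \<beta> (Suc j)"
      using c_rec[of j] c_pos[of "Suc j"] by (simp add: field_simps)
    moreover have "DD (Suc j) j (U j f) = D j (U j f)"
      by (simp add: DD_Suc DD_self mat_op_in_fun_space del: down_prod.simps)
    ultimately show ?thesis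
      using base T_Suc[of f j] by (simp only: Suc DD_self diff_Suc_1 add.commute)
  qed
next
  case (step n)
  have eq: "\<beta> (Suc n) * (x / c (Suc n)) = x / c (Suc (Suc n))" for x
    using c_rec[of n] c_pos[of n] c_pos[of "Suc n"] by (simp add: field_simps)
  have eq': "\<beta> (Suc n) * (1 - x / c (Suc n)) + (1 - \<beta> (Suc n)) = 1 - x / c (Suc (Suc n))" for x
    using eq[of x] by (simp add: right_diff_distrib)
  have "i - 1 \<le> n" using step.hyps(1) by simp
  have "T (Suc n) (DD (Suc n) i f) = D n (fun_scale (\<beta> (Suc n)) (fun_scale (1 - c i / c (Suc n)) (DD n i f)
    + fun_scale (c i / c (Suc n)) (DD n (i - 1) (U (i - 1) f))) + fun_scale (1 - \<beta> (Suc n)) (DD n i f))"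
    unfolding DD_Suc[OF step.hyps(1)] T_D step.IH[OF step.prems] ..
  also have "\<dots> = fun_scale (\<beta> (Suc n) * (1 - c i / c (Suc n)) + (1 - \<beta> (Suc n))) (DD (Suc n) i f)
    + fun_scale (\<beta> (Suc n) * (c i / c (Suc n))) (DD (Suc n) (i - 1) (U (i - 1) f))"
    unfolding DD_Suc[OF step.hyps(1)] DD_Suc[OF \<open>i - 1 \<le> n\<close>] mat_op.add mat_op.scale
    by (simp only: fun_vs.scale_right_distrib fun_vs.scale_left_distrib fun_vs.scale_scale add_ac)
  finally show ?case
    by (simp only: eq eq')
qed

section \<open>Projections onto the kernels of the up operators\<close>

definition P :: "nat \<Rightarrow> ('a \<Rightarrow> real) \<Rightarrow> 'a \<Rightarrow> real" where
  "P k f = (\<Sum>i\<le>k. fun_scale (eta \<beta> i k) (DD k i (UU i k f)))"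

lemma linear_P: "Vector_Spaces.linear fun_scale fun_scale (P k)"
proof
  show "P k (f + g) = P k f + P k g" for f g
    by (simp add: P_def mat_op.add fun_vs.scale_right_distrib sum.distrib)
  show "P k (fun_scale a f) = fun_scale a (P k f)" for a f
    by (simp add: P_def mat_op.scale fun_vs.scale_sum_right mult.commute)
qed

lemma P_in_fun_space: "P k f \<in> fun_space (S k)"
  unfolding P_def
  by (intro fun_vs.subspace_sum fun_vs.subspace_scale subspace_fun_space mat_op_in_fun_space)

lemma eta_self: "eta \<beta> k k = 1"
  by (simp add: eta_def)

text \<open>Splits off the factor \<open>m = i\<close> while \<open>k\<close> stays fixed; with
  \<open>eta_self\<close> this is what the cancellation in \<open>U_P\<close> rests on.\<close>

lemma eta_rec:
  assumes "i < k"
  shows "eta \<beta> i k = c (Suc i) / (c i - c k) * eta \<beta> (Suc i) k"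
  using assms by (simp add: eta_def c_def prod.atLeast_Suc_lessThan)

text \<open>As \<open>U D = T\<close>, \<open>T_DD\<close> expresses the image of the
  \<open>i\<close>-th summand through \<open>A i\<close> and \<open>A (i - 1)\<close>. The total
  coefficient of each \<open>A i\<close> vanishes by \<open>eta_rec\<close>.\<close>

lemma U_P:
  assumes "f \<in> fun_space (S (Suc n))"
  shows "U n (P (Suc n) f) = 0"
proof -
  define A where "A i = DD n i (UU i (Suc n) f)" for i
  define x where "x i = c i / c (Suc n)" for i
  have U_DD: "U n (DD (Suc n) i (UU i (Suc n) f)) = fun_scale (1 - x i) (A i) + fun_scale (x i) (A (i - 1))"
    if "i \<le> n" for i
  proof -
    have "U (i - 1) (UU i (Suc n) f) = UU (i - 1) (Suc n) f" if "i \<noteq> 0"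
      using U_UU[of "i - 1" n f] that \<open>i \<le> n\<close> assms by (simp del: up_prod.simps)
    then have "fun_scale (x i) (DD n (i - 1) (U (i - 1) (UU i (Suc n) f))) = fun_scale (x i) (A (i - 1))"
      by (cases "i = 0") (simp_all add: A_def x_def c_0 del: up_prod.simps)
    then show ?thesis
      using T_DD[OF that mat_op_in_fun_space] that
      by (simp add: DD_Suc T_eq[symmetric] A_def x_def del: down_prod.simps up_prod.simps)
  qed
  have U_top: "U n (DD (Suc n) (Suc n) (UU (Suc n) (Suc n) f)) = A n"
    using assms by (simp add: A_def UU_self DD_self UU_Suc mat_op_in_fun_space
        del: up_prod.simps down_prod.simps)
  have coeff: "eta \<beta> i (Suc n) * (1 - x i) + eta \<beta> (Suc i) (Suc n) * x (Suc i) = 0" if "i \<le> n" for i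
  proof -
    have "c i - c (Suc n) < 0" using c_mono[of i "Suc n"] that by simp
    then show ?thesis
      using c_pos[of n] eta_rec[of i "Suc n"] that by (simp add: x_def field_simps)
  qed
  have "U n (P (Suc n) f) = (\<Sum>i\<le>n. fun_scale (eta \<beta> i (Suc n)) (fun_scale (1 - x i) (A i) + fun_scale (x i) (A (i - 1)))) + A n"
    unfolding P_def
    by (simp add: mat_op.sum mat_op.add mat_op.scale U_DD U_top eta_self
        del: up_prod.simps down_prod.simps)
  \<comment> \<open>As \<open>x (Suc n) = 1\<close>, the top term \<open>A n\<close> serves as the
    summand \<open>i = Suc n\<close> of the second sum.\<close>
  also have "\<dots> = (\<Sum>i\<le>n. fun_scale (eta \<beta> i (Suc n) * (1 - x i)) (A i))
     + ((\<Sum>i\<le>n. fun_scale (eta \<beta> i (Suc n) * x i) (A (i - 1))) + fun_scale (eta \<beta> (Suc n) (Suc n) * x (Suc n)) (A n))"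
    using c_pos[of n]
    by (simp add: fun_vs.scale_right_distrib sum.distrib eta_self x_def add.assoc)
  also have "(\<Sum>i\<le>n. fun_scale (eta \<beta> i (Suc n) * x i) (A (i - 1))) + fun_scale (eta \<beta> (Suc n) (Suc n) * x (Suc n)) (A n)
      = (\<Sum>i\<le>Suc n. fun_scale (eta \<beta> i (Suc n) * x i) (A (i - 1)))"
    by simp
  \<comment> \<open>The summand \<open>i = 0\<close>, with its truncated \<open>A (0 - 1)\<close>,
    drops out because \<open>x 0 = 0\<close>.\<close>
  also have "\<dots> = (\<Sum>i\<le>n. fun_scale (eta \<beta> (Suc i) (Suc n) * x (Suc i)) (A i))"
    by (subst sum.atMost_Suc_shift) (simp add: x_def c_0)
  also have "(\<Sum>i\<le>n. fun_scale (eta \<beta> i (Suc n) * (1 - x i)) (A i)) + \<dots> =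
      (\<Sum>i\<le>n. fun_scale (eta \<beta> i (Suc n) * (1 - x i) + eta \<beta> (Suc i) (Suc n) * x (Suc i)) (A i))"
    by (simp add: fun_vs.scale_left_distrib sum.distrib)
  also have "\<dots> = 0"
    using coeff by simp
  finally show ?thesis .
qed

lemma P_0: "f \<in> fun_space (S 0) \<Longrightarrow> P 0 f = f"
  by (simp add: P_def UU_self DD_self eta_self del: up_prod.simps down_prod.simps)

text \<open>The summand \<open>i = Suc n\<close> is \<open>f\<close>; every other one first applies
  \<open>U n\<close> and last \<open>D n\<close>. So \<open>P - I\<close> vanishes on the kernel of
  \<open>U\<close> and maps into the image of \<open>D\<close>.\<close>

lemma P_Suc:
  assumes "f \<in> fun_space (S (Suc n))"
  shows "P (Suc n) f = f + D n (\<Sum>i\<le>n. fun_scale (eta \<beta> i (Suc n)) (DD n i (UU i n (U n f))))"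
proof -
  have "P (Suc n) f = (\<Sum>i\<le>n. fun_scale (eta \<beta> i (Suc n)) (DD (Suc n) i (UU i (Suc n) f))) + f"
    using assms by (simp add: P_def UU_self DD_self eta_self del: up_prod.simps down_prod.simps)
  also have "(\<Sum>i\<le>n. fun_scale (eta \<beta> i (Suc n)) (DD (Suc n) i (UU i (Suc n) f))) =
      D n (\<Sum>i\<le>n. fun_scale (eta \<beta> i (Suc n)) (DD n i (UU i n (U n f))))"
    by (simp add: DD_Suc UU_Suc mat_op.sum mat_op.scale del: up_prod.simps down_prod.simps)
  finally show ?thesis
    by (simp only: add.commute)
qed

lemma P_eq_self:
  assumes "f \<in> fun_space (S (Suc n))" "U n f = 0"
  shows "P (Suc n) f = f"
  using assms by (simp add: P_Suc del: up_prod.simps down_prod.simps)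

text \<open>The second term of \<open>T_DD\<close> is killed by \<open>U_P\<close>, or by
  \<open>c 0 = 0\<close> when \<open>k = 0\<close>.\<close>

lemma T_DD_P:
  assumes "k \<le> n" "f \<in> fun_space (S k)"
  shows "T n (DD n k (P k f)) = fun_scale (1 - c k / c (Suc n)) (DD n k (P k f))"
proof -
  have "fun_scale (c k / c (Suc n)) (DD n (k - 1) (U (k - 1) (P k f))) = 0"
    using assms by (cases k) (simp_all add: c_0 U_P)
  then show ?thesis
    using T_DD[OF assms(1) P_in_fun_space] by simp
qed

text \<open>The projection splits off a part in the kernel of \<open>U\<close>; the rest is
  \<open>D\<close> of a function one level lower, to which the induction applies.\<close>

lemma decomposition:
  assumes "f \<in> fun_space (S n)"
  shows "\<exists>g. (\<forall>k\<le>n. g k \<in> fun_space (S k)) \<and> f = (\<Sum>k\<le>n. DD n k (P k (g k)))"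
  using assms
proof (induction n arbitrary: f)
  case 0
  then show ?case
    by (intro exI[of _ "\<lambda>_. f"]) (simp add: P_0 DD_self del: down_prod.simps)
next
  case (Suc n)
  define q where "q = (\<Sum>i\<le>n. fun_scale (eta \<beta> i (Suc n)) (DD n i (UU i n (U n f))))"
  have "- q \<in> fun_space (S n)"
    unfolding q_def
    by (intro fun_vs.subspace_neg fun_vs.subspace_sum fun_vs.subspace_scale subspace_fun_space
        mat_op_in_fun_space)
  then obtain g where g: "\<forall>k\<le>n. g k \<in> fun_space (S k)" "- q = (\<Sum>k\<le>n. DD n k (P k (g k)))"
    using Suc.IH by blast
  define g' where "g' = g(Suc n := f)"
  have "f = D n (- q) + P (Suc n) f"
    using P_Suc[OF Suc.prems] by (simp add: q_def mat_op.neg del: up_prod.simps down_prod.simps)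
  also have "D n (- q) = (\<Sum>k\<le>n. DD (Suc n) k (P k (g' k)))"
    unfolding g(2) mat_op.sum by (intro sum.cong) (simp_all add: DD_Suc g'_def del: down_prod.simps)
  also have "\<dots> + P (Suc n) f = (\<Sum>k\<le>Suc n. DD (Suc n) k (P k (g' k)))"
    by (simp add: DD_self P_in_fun_space g'_def del: down_prod.simps)
  finally have "f = (\<Sum>k\<le>Suc n. DD (Suc n) k (P k (g' k)))" .
  moreover have "\<forall>k\<le>Suc n. g' k \<in> fun_space (S k)"
    using g(1) Suc.prems by (simp add: g'_def le_Suc_eq)
  ultimately show ?case by blast
qed

section \<open>Eigenvalues and injectivity\<close>

text \<open>Either \<open>U f = 0\<close> and \<open>T_Suc\<close> gives the eigenvalue
  \<open>1 - \<beta>\<close>, or \<open>U f\<close> is an eigenfunction one level down.\<close>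

lemma eigenvalue_cases:
  assumes "f \<in> fun_space (S n)" "T n f = fun_scale \<mu> f" "f \<noteq> 0"
  shows "\<exists>k\<le>n. \<mu> = 1 - c k / c (Suc n)"
  using assms
proof (induction n arbitrary: f \<mu>)
  case 0
  then obtain x where "f x \<noteq> 0" by (auto simp: fun_eq_iff)
  moreover have "f = fun_scale \<mu> f"
    using T_0[OF 0(1)] 0(2) by (rule trans[OF sym])
  then have "f x = \<mu> * f x"
    by (metis fun_scale_def)
  ultimately show ?case
    by (simp add: c_0)
next
  case (Suc n)
  have ratio: "c (Suc n) / c (Suc (Suc n)) = \<beta> (Suc n)"
    using c_rec[of n] c_pos[of "Suc n"] by (simp add: field_simps)
  show ?case
  proof (cases "U n f = 0")
    case True
    have "fun_scale \<mu> f = fun_scale (1 - \<beta> (Suc n)) f"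
      using T_Suc[OF Suc.prems(1)] Suc.prems(2) True by simp
    then have "\<mu> = 1 - \<beta> (Suc n)"
      using Suc.prems(3) by simp
    then show ?thesis
      using ratio by (intro exI[of _ "Suc n"]) simp
  next
    case False
    \<comment> \<open>Solves \<open>\<mu> = \<beta> \<nu> + (1 - \<beta>)\<close>, the relation that
      \<open>U_T\<close> imposes on eigenvalues of consecutive levels.\<close>
    let ?\<nu> = "(\<mu> - (1 - \<beta> (Suc n))) / \<beta> (Suc n)"
    have eq: "fun_scale \<mu> (U n f) =
        fun_scale (\<beta> (Suc n)) (T n (U n f)) + fun_scale (1 - \<beta> (Suc n)) (U n f)"
      using U_T[OF Suc.prems(1)] unfolding Suc.prems(2) mat_op.scale .
    have "T n (U n f) = fun_scale ?\<nu> (U n f)"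
    proof
      fix x
      show "T n (U n f) x = fun_scale ?\<nu> (U n f) x"
        using fun_cong[OF eq, of x] \<beta>_bounds(1)[of n] by (simp add: fun_scale_def field_simps)
    qed
    then obtain k where k: "k \<le> n" "?\<nu> = 1 - c k / c (Suc n)"
      using Suc.IH[OF mat_op_in_fun_space _ False] by blast
    have "\<mu> = \<beta> (Suc n) * ?\<nu> + (1 - \<beta> (Suc n))"
      using \<beta>_bounds(1)[of n] by simp
    also have "\<dots> = 1 - \<beta> (Suc n) * (c k / c (Suc n))"
      unfolding k(2) by (simp add: right_diff_distrib)
    also have "\<beta> (Suc n) * (c k / c (Suc n)) = c k / c (Suc (Suc n))"
      using c_rec[of n] c_pos[of n] c_pos[of "Suc n"] by (simp add: field_simps)
    finally show ?thesis
      using k(1) le_Suc_eq by blast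
  qed
qed

text \<open>Eigenvalue 0 would force \<open>c k = c (Suc n)\<close> with \<open>k \<le> n\<close>,
  against strict monotonicity.\<close>

lemma T_injective:
  assumes "f \<in> fun_space (S n)" "T n f = 0"
  shows "f = 0"
proof (rule ccontr)
  assume "f \<noteq> 0"
  moreover have "T n f = fun_scale 0 f"
    using assms by simp
  ultimately obtain k where "k \<le> n" "0 = 1 - c k / c (Suc n)"
    using eigenvalue_cases[OF assms(1)] by blast
  then show False
    using c_mono[of k "Suc n"] c_pos[of n] by (simp add: field_simps)
qed

lemma D_injective:
  assumes "f \<in> fun_space (S n)" "D n f = 0"
  shows "f = 0"
  by (rule T_injective[OF assms(1)]) (simp only: T_eq assms(2) mat_op.zero)

lemma DD_injective:
  assumes "k \<le> n" "f \<in> fun_space (S k)" "DD n k f = 0"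
  shows "f = 0"
  using assms
proof (induction n rule: dec_induct)
  case base
  then show ?case by (simp add: DD_self del: down_prod.simps)
next
  case (step n)
  have "D n (DD n k f) = 0"
    using step.prems(2) unfolding DD_Suc[OF step.hyps(1)] .
  then show ?case
    using step.IH step.prems(1) D_injective mat_op_in_fun_space by blast
qed


section \<open>The functions $h_s$\<close>

text \<open>The index is the target level of \<open>U n\<close>; the functions live one level
  higher.\<close>

definition ker_U :: "nat \<Rightarrow> ('a \<Rightarrow> real) set" where
  "ker_U n = {f \<in> fun_space (S (Suc n)). U n f = 0}"

lemma subspace_ker_U: "fun_vs.subspace (ker_U n)"
proof -
  have "ker_U n = fun_space (S (Suc n)) \<inter> {f. U n f = 0}"
    by (auto simp: ker_U_def)
  then show ?thesis
    by (simp only: fun_vs.subspace_inter subspace_fun_space mat_op.subspace_kernel)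
qed

text \<open>\<open>P\<close> maps into the kernel by \<open>U_P\<close> and fixes it by
  \<open>P_eq_self\<close>.\<close>

lemma P_image: "P (Suc n) ` fun_space (S (Suc n)) = ker_U n"
proof
  show "ker_U n \<subseteq> P (Suc n) ` fun_space (S (Suc n))"
  proof
    fix f assume "f \<in> ker_U n"
    then have "f \<in> fun_space (S (Suc n))" "P (Suc n) f = f"
      by (auto simp: ker_U_def P_eq_self)
    then show "f \<in> P (Suc n) ` fun_space (S (Suc n))"
      by (metis imageI)
  qed
qed (auto simp: ker_U_def U_P P_in_fun_space)

text \<open>Functions on level \<open>Suc n\<close> are the direct sum of \<open>ker_U n\<close> and
  the image of the injective \<open>D n\<close>.\<close>

lemma dim_ker_U: "fun_vs.dim (ker_U n) + card (S n) = card (S (Suc n))"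
proof -
  obtain A where A: "A \<subseteq> ker_U n" "fun_vs.independent A" "ker_U n \<subseteq> fun_vs.span A"
      "card A = fun_vs.dim (ker_U n)"
    using fun_vs.basis_exists[of "ker_U n"] by metis
  have span_A: "fun_vs.span A = ker_U n"
    using A subspace_ker_U by (intro fun_vs.span_subspace)
  have "A \<subseteq> fun_vs.span (mat_id ` S (Suc n))"
    using A(1) by (auto simp: ker_U_def span_mat_id finite_S)
  then have fin_A: "finite A"
    using fun_vs.independent_span_bound[OF _ A(2)] finite_S by blast
  define B where "B = D n ` mat_id ` S n"
  have inj: "inj_on (D n) (fun_space (S n))"
  proof (rule inj_onI)
    fix f g assume fg: "f \<in> fun_space (S n)" "g \<in> fun_space (S n)" "D n f = D n g"
    have "f - g \<in> fun_space (S n)"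
      by (rule fun_vs.subspace_diff[OF subspace_fun_space fg(1,2)])
    moreover have "D n (f - g) = 0"
      by (simp only: mat_op.diff fg(3) diff_self)
    ultimately have "f - g = 0"
      by (rule D_injective)
    then show "f = g"
      by (simp only: right_minus_eq)
  qed
  have span_B: "fun_vs.span B = D n ` fun_space (S n)"
    unfolding B_def mat_op.span_image by (simp only: span_mat_id finite_S)
  have indep_B: "fun_vs.independent B"
    unfolding B_def using inj
    by (intro mat_op.independent_injective_image independent_mat_id) (simp_all add: span_mat_id finite_S)
  have "inj_on (D n) (mat_id ` S n)"
    using inj by (rule inj_on_subset) (auto intro: mat_id_in_fun_space)
  then have card_B: "card B = card (S n)"
    unfolding B_def by (simp only: card_image card_mat_id_image)
  \<comment> \<open>If \<open>f = D n g\<close> and \<open>U n f = 0\<close>, then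
    \<open>T n g = 0\<close>, whence \<open>g = 0\<close>.\<close>
  have direct: "fun_vs.span A \<inter> fun_vs.span B \<subseteq> {0}"
  proof
    fix f assume "f \<in> fun_vs.span A \<inter> fun_vs.span B"
    then obtain g where g: "g \<in> fun_space (S n)" "f = D n g" "U n f = 0"
      by (auto simp: span_A span_B ker_U_def)
    have "T n g = 0"
      unfolding T_eq g(2)[symmetric] by (rule g(3))
    with g(1) have "g = 0"
      by (rule T_injective)
    then show "f \<in> {0}"
      using g(2) by (simp only: mat_op.zero singleton_iff)
  qed
  have "fun_vs.span (A \<union> B) = fun_space (S (Suc n))"
  proof
    have "A \<subseteq> fun_space (S (Suc n))" "B \<subseteq> fun_space (S (Suc n))"
      using A(1) by (auto simp: ker_U_def B_def mat_op_in_fun_space)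
    then show "fun_vs.span (A \<union> B) \<subseteq> fun_space (S (Suc n))"
      by (intro fun_vs.span_minimal subspace_fun_space) auto
    show "fun_space (S (Suc n)) \<subseteq> fun_vs.span (A \<union> B)"
    proof
      fix f assume f: "f \<in> fun_space (S (Suc n))"
      \<comment> \<open>The correction term of \<open>P_Suc\<close>, so that
        \<open>f = P (Suc n) f - D n q\<close>.\<close>
      define q where "q = (\<Sum>i\<le>n. fun_scale (eta \<beta> i (Suc n)) (DD n i (UU i n (U n f))))"
      have "q \<in> fun_space (S n)"
        unfolding q_def
        by (intro fun_vs.subspace_sum fun_vs.subspace_scale subspace_fun_space mat_op_in_fun_space)
      then have "D n q \<in> fun_vs.span B"
        by (simp only: span_B imageI)
      moreover have "P (Suc n) f \<in> fun_vs.span A"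
        using f P_image by (auto simp: span_A)
      ultimately have "P (Suc n) f - D n q \<in> fun_vs.span (A \<union> B)"
        using fun_vs.span_mono[of A "A \<union> B"] fun_vs.span_mono[of B "A \<union> B"]
        by (intro fun_vs.span_diff) auto
      moreover have "P (Suc n) f - D n q = f"
        unfolding P_Suc[OF f] q_def by (rule add_diff_cancel_right')
      ultimately show "f \<in> fun_vs.span (A \<union> B)" by (simp only:)
    qed
  qed
  then have "card (S (Suc n)) = fun_vs.dim (fun_vs.span (A \<union> B))"
    by (simp only: dim_fun_space finite_S)
  also have "\<dots> = card A + card B"
    using fin_A A(2) indep_B direct finite_S by (intro fun_vs.dim_direct_sum) (simp_all add: B_def)
  finally show ?thesis
    using A(4) card_B by simp
qed

section \<open>Spans and dimensions of the functions \<open>h_fun\<close>\<close>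

lemma level_eq: "s \<in> S n \<Longrightarrow> level S s = n"
  unfolding level_def using disjoint_S
  by (intro the_equality) (auto simp: disjoint_family_on_def)

text \<open>Grouped by the level of \<open>r\<close>, the defining sum becomes that of
  \<open>P k\<close> at the point mass of \<open>s\<close>; composing down products accounts for
  \<open>DD n k\<close>.\<close>

lemma restr_h_fun:
  assumes "k \<le> n" "s \<in> S k"
  shows "restr (S n) (h_fun S pu pd \<beta> s) = DD n k (P k (mat_id s))"
proof
  fix u
  show "restr (S n) (h_fun S pu pd \<beta> s) u = DD n k (P k (mat_id s)) u"
  proof (cases "u \<in> S n")
    case True
    have levels: "{r \<in> (\<Union>n. S n). level S r \<le> k} = (\<Union>i\<le>k. S i)"
      using level_eq by auto
    have DD_DD: "DD n k (DD k i f) = DD n i f" if "i \<le> k" for i f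
      using assms(1)
    proof (induction n rule: dec_induct)
      case base
      then show ?case by (rule DD_self[OF mat_op_in_fun_space])
    next
      case (step m)
      then show ?case
        using that by (simp only: DD_Suc[OF step.hyps(1)] DD_Suc[of i m])
    qed
    have "restr (S n) (h_fun S pu pd \<beta> s) u = (\<Sum>r\<in>(\<Union>i\<le>k. S i).
        up_prod S pu (level S r) k r s * eta \<beta> (level S r) k * d_fun S pd r u)"
      unfolding restr_def if_P[OF True] h_fun_def level_eq[OF assms(2)] levels ..
    also have "\<dots> = (\<Sum>i\<le>k. \<Sum>r\<in>S i.
        up_prod S pu (level S r) k r s * eta \<beta> (level S r) k * d_fun S pd r u)"
      using finite_S disjoint_S
      by (intro sum.UNION_disjoint) (auto simp: disjoint_family_on_def)
    also have "\<dots> = (\<Sum>i\<le>k. eta \<beta> i k * DD n i (UU i k (mat_id s)) u)"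
    proof (intro sum.cong refl)
      fix i assume "i \<in> {..k}"
      then have "(\<Sum>r\<in>S i. up_prod S pu (level S r) k r s * eta \<beta> (level S r) k * d_fun S pd r u)
          = (\<Sum>r\<in>S i. eta \<beta> i k * (down_prod S pd n i u r * up_prod S pu i k r s))"
        using assms(1) by (intro sum.cong) (auto simp: level_eq d_fun_def level_eq[OF True])
      \<comment> \<open>Applied to \<open>mat_id s\<close>, the up product yields its column
        \<open>s\<close>.\<close>
      also have "\<dots> = eta \<beta> i k * DD n i (UU i k (mat_id s)) u"
        using True assms(2) by (simp add: mat_op_apply sum_mat_id_right finite_S sum_distrib_left
            cong: sum.cong)
      finally show "(\<Sum>r\<in>S i. up_prod S pu (level S r) k r s * eta \<beta> (level S r) k * d_fun S pd r u)
          = eta \<beta> i k * DD n i (UU i k (mat_id s)) u" .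
    qed
    also have "\<dots> = (\<Sum>i\<le>k. fun_scale (eta \<beta> i k) (DD n i (UU i k (mat_id s)))) u"
      by (simp add: sum_fun_apply fun_scale_def)
    also have "(\<Sum>i\<le>k. fun_scale (eta \<beta> i k) (DD n i (UU i k (mat_id s)))) = DD n k (P k (mat_id s))"
      unfolding P_def mat_op.sum mat_op.scale by (intro sum.cong) (simp_all only: DD_DD atMost_iff)
    finally show ?thesis .
  qed (simp add: restr_def mat_op_def)
qed

text \<open>By \<open>restr_h_fun\<close> the family is the image of a basis under a linear
  map.\<close>

lemma span_h_fun_level:
  assumes "k \<le> n"
  shows "fun_vs.span ((\<lambda>s. restr (S n) (h_fun S pu pd \<beta> s)) ` S k) = DD n k ` P k ` fun_space (S k)"
proof -
  interpret P: Vector_Spaces.linear fun_scale fun_scale "P k"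
    by (rule linear_P)
  have "(\<lambda>s. restr (S n) (h_fun S pu pd \<beta> s)) ` S k = DD n k ` P k ` mat_id ` S k"
    using restr_h_fun[OF assms] by (simp add: image_image)
  then show ?thesis
    by (simp only: mat_op.span_image P.span_image span_mat_id finite_S)
qed

lemma span_h_fun:
  "fun_vs.span ((\<lambda>s. restr (S n) (h_fun S pu pd \<beta> s)) ` (\<Union>k\<le>n. S k)) = fun_space (S n)"
    (is "fun_vs.span ?H = _")
proof (rule fun_vs.span_subspace)
  show "?H \<subseteq> fun_space (S n)"
    by (auto intro: restr_in_fun_space)
  show "fun_space (S n) \<subseteq> fun_vs.span ?H"
  proof
    fix f assume "f \<in> fun_space (S n)"
    then obtain g where g: "\<forall>k\<le>n. g k \<in> fun_space (S k)" "f = (\<Sum>k\<le>n. DD n k (P k (g k)))"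
      using decomposition by blast
    have "DD n k (P k (g k)) \<in> fun_vs.span ?H" if "k \<le> n" for k
    proof -
      have "DD n k (P k (g k)) \<in> DD n k ` P k ` fun_space (S k)"
        using g(1) that by blast
      also have "\<dots> \<subseteq> fun_vs.span ?H"
        unfolding span_h_fun_level[OF that, symmetric] using that by (intro fun_vs.span_mono) auto
      finally show ?thesis .
    qed
    then show "f \<in> fun_vs.span ?H"
      unfolding g(2) by (intro fun_vs.span_sum) auto
  qed
qed (rule subspace_fun_space)

text \<open>\<open>DD n k\<close> preserves dimensions, so only the range of \<open>P k\<close>
  counts: everything on the one-point level 0, the kernel of \<open>U\<close> above it.\<close>

lemma dim_span_h_fun:
  assumes "k \<le> n"
  shows "int (fun_vs.dim (fun_vs.span ((\<lambda>s. restr (S n) (h_fun S pu pd \<beta> s)) ` S k))) =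
    (if k = 0 then 1 else int (card (S k)) - int (card (S (k - 1))))"
proof -
  have dim: "fun_vs.dim (DD n k ` V) = fun_vs.dim V" if "fun_vs.subspace V" "V \<subseteq> fun_space (S k)" for V
    using that DD_injective[OF assms] by (intro mat_op.dim_image_inj) auto
  show ?thesis
  proof (cases k)
    case 0
    have "P 0 ` fun_space (S 0) = fun_space (S 0)"
      using P_0 by force
    then have "fun_vs.dim (DD n k ` P k ` fun_space (S k)) = 1"
      using dim[OF subspace_fun_space] by (simp add: 0 dim_fun_space S_0 del: down_prod.simps)
    then show ?thesis
      unfolding span_h_fun_level[OF assms] by (simp add: 0)
  next
    case (Suc m)
    have "fun_vs.dim (DD n k ` P k ` fun_space (S k)) = fun_vs.dim (ker_U m)"
      using dim[OF subspace_ker_U[of m]] unfolding Suc P_image by (auto simp: ker_U_def)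
    then show ?thesis
      unfolding span_h_fun_level[OF assms] using dim_ker_U[of m] by (simp add: Suc)
  qed
qed

lemma h_fun_eigenfunction:
  assumes "k \<le> n" "s \<in> S k"
  shows "T n (restr (S n) (h_fun S pu pd \<beta> s)) =
    fun_scale (1 - c k / c (Suc n)) (restr (S n) (h_fun S pu pd \<beta> s))"
  unfolding restr_h_fun[OF assms] using assms by (intro T_DD_P mat_id_in_fun_space)


section \<open>Ergodicity\<close>

definition const_one :: "nat \<Rightarrow> 'a \<Rightarrow> real" where
  "const_one n = restr (S n) (\<lambda>_. 1)"

lemma U_const_one: "U n (const_one (Suc n)) = const_one n"
  using stochastic_up[of n] by (intro ext) (auto simp: const_one_def mat_op_def restr_def stochastic_def)

lemma D_const_one: "D n (const_one n) = const_one (Suc n)"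
  using stochastic_down[of n] by (intro ext) (auto simp: const_one_def mat_op_def restr_def stochastic_def)

lemma const_one_in_fun_space: "const_one n \<in> fun_space (S n)"
  by (simp add: const_one_def restr_in_fun_space)

lemma UU_const_one: "UU 0 n (const_one n) = const_one 0"
proof (induction n)
  case 0
  show ?case by (rule UU_self[OF const_one_in_fun_space])
next
  case (Suc n)
  then show ?case by (simp only: UU_Suc le0 U_const_one)
qed

lemma DD_const_one: "DD n 0 (const_one 0) = const_one n"
proof (induction n)
  case 0
  show ?case by (rule DD_self[OF const_one_in_fun_space])
next
  case (Suc n)
  then show ?case by (simp only: DD_Suc le0 D_const_one)
qed

lemma fun_space_S_0:
  assumes "f \<in> fun_space (S 0)"
  shows "f = fun_scale (f e) (const_one 0)"
  using assms by (intro ext) (auto simp: fun_scale_def const_one_def restr_def fun_space_def S_0)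

text \<open>At \<open>e\<close>, \<open>UU 0 n f\<close> is the integral of \<open>f\<close> against
  \<open>up_prod S pu 0 n e\<close>, so this is the invariance of that law. The two coefficients in
  \<open>U_T\<close> add up to 1.\<close>

lemma UU_T:
  assumes "f \<in> fun_space (S n)"
  shows "UU 0 n (T n f) = UU 0 n f"
  using assms
proof (induction n arbitrary: f)
  case 0
  then show ?case by (simp only: T_0)
next
  case (Suc n)
  have "UU 0 (Suc n) (T (Suc n) f) =
      fun_scale (\<beta> (Suc n)) (UU 0 n (T n (U n f))) + fun_scale (1 - \<beta> (Suc n)) (UU 0 n (U n f))"
    by (simp only: UU_Suc le0 U_T[OF Suc.prems] mat_op.add mat_op.scale)
  also have "\<dots> = fun_scale (\<beta> (Suc n) + (1 - \<beta> (Suc n))) (UU 0 n (U n f))"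
    by (simp only: Suc.IH[OF mat_op_in_fun_space] fun_vs.scale_left_distrib)
  also have "\<dots> = UU 0 (Suc n) f"
    by (simp add: UU_Suc del: up_prod.simps)
  finally show ?case .
qed

lemma sum_up_prod: "(\<Sum>s\<in>S n. up_prod S pu 0 n e s * f s) = UU 0 n f e"
  by (simp add: mat_op_apply S_0)

lemma up_prod_nonneg: "s \<in> S n \<Longrightarrow> 0 \<le> up_prod S pu 0 n e s"
proof (induction n arbitrary: s)
  case (Suc n)
  then show ?case
    using stochastic_up[of n] by (auto simp: mat_mult_def stochastic_def intro!: sum_nonneg)
qed (simp add: mat_id_def)

lemma stationary_up_prod:
  "stationary_distribution (S n) (chain_mat S pu pd n) (up_prod S pu 0 n e)"
  unfolding stationary_distribution_def
proof (intro conjI ballI)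
  have "(\<Sum>s\<in>S n. up_prod S pu 0 n e s) = (\<Sum>s\<in>S n. up_prod S pu 0 n e s * const_one n s)"
    by (intro sum.cong) (auto simp: const_one_def restr_def)
  also have "\<dots> = 1"
    by (simp only: sum_up_prod UU_const_one) (simp add: const_one_def restr_def S_0)
  finally show "(\<Sum>s\<in>S n. up_prod S pu 0 n e s) = 1" .
  fix s assume s: "s \<in> S n"
  \<comment> \<open>Column \<open>s\<close> of the transition matrix is \<open>T n\<close> of the
    point mass at \<open>s\<close>.\<close>
  have "(\<Sum>r\<in>S n. up_prod S pu 0 n e r * chain_mat S pu pd n r s) =
      (\<Sum>r\<in>S n. up_prod S pu 0 n e r * T n (mat_id s) r)"
    using s by (intro sum.cong) (simp_all add: mat_op_apply sum_mat_id_right finite_S)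
  also have "\<dots> = (\<Sum>r\<in>S n. up_prod S pu 0 n e r * mat_id s r)"
    using s by (simp only: sum_up_prod UU_T mat_id_in_fun_space)
  also have "\<dots> = up_prod S pu 0 n e s"
    using s by (simp only: sum_mat_id_right finite_S)
  finally show "(\<Sum>r\<in>S n. up_prod S pu 0 n e r * chain_mat S pu pd n r s) = up_prod S pu 0 n e s" .
qed (rule up_prod_nonneg)

section \<open>Convergence and uniqueness\<close>

lemma T_funpow_DD_P:
  assumes "k \<le> n" "f \<in> fun_space (S k)"
  shows "(T n ^^ t) (DD n k (P k f)) = fun_scale ((1 - c k / c (Suc n)) ^ t) (DD n k (P k f))"
proof (induction t)
  case (Suc t)
  then show ?case
    using T_DD_P[OF assms] by (simp add: mat_op.scale mult.commute)
qed simp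

lemma T_funpow_sum: "(T n ^^ t) (\<Sum>k\<in>K. f k) = (\<Sum>k\<in>K. (T n ^^ t) (f k))"
  by (induction t) (simp_all add: mat_op.sum)

text \<open>Only the component of \<open>f\<close> with eigenvalue 1, which is constant, survives: the others decay
  under iteration and are annihilated by every stationary distribution.\<close>

lemma T_funpow_limit:
  assumes "f \<in> fun_space (S n)"
  shows "\<exists>a. (\<forall>r\<in>S n. (\<lambda>t. (T n ^^ t) f r) \<longlonglongrightarrow> a) \<and>
    (\<forall>\<nu>. stationary_distribution (S n) (chain_mat S pu pd n) \<nu> \<longrightarrow> (\<Sum>s\<in>S n. \<nu> s * f s) = a)"
proof -
  obtain g where g: "\<forall>k\<le>n. g k \<in> fun_space (S k)" "f = (\<Sum>k\<le>n. DD n k (P k (g k)))"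
    using decomposition[OF assms] by blast
  define F where "F k = DD n k (P k (g k))" for k
  define l where "l k = 1 - c k / c (Suc n)" for k
  \<comment> \<open>The component from level 0 is constant with this value, because
    \<open>DD n 0\<close> preserves constants.\<close>
  define a where "a = g 0 e"
  have g0: "g 0 \<in> fun_space (S 0)" using g(1) by simp
  have "F 0 = DD n 0 (fun_scale a (const_one 0))"
    unfolding F_def P_0[OF g0] a_def fun_space_S_0[OF g0, symmetric] ..
  then have F_0: "F 0 r = a" if "r \<in> S n" for r
    using that by (simp add: mat_op.scale DD_const_one del: down_prod.simps)
      (simp add: fun_scale_def const_one_def restr_def)
  \<comment> \<open>Strict growth of \<open>c\<close> from \<open>c 0 = 0\<close> places the
    remaining eigenvalues in [0, 1).\<close>
  have l: "0 \<le> l k" "l k < 1" if "0 < k" "k \<le> n" for k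
    using that c_mono[of 0 k] c_mono[of k "Suc n"] c_pos[of n] by (auto simp: l_def c_0 field_simps)
  have l_0: "l 0 = 1" by (simp add: l_def c_0)
  have power: "(T n ^^ t) (F k) = fun_scale (l k ^ t) (F k)" if "k \<le> n" for k t
    unfolding F_def l_def using that g(1) by (intro T_funpow_DD_P) auto
  have "(\<lambda>t. (T n ^^ t) f r) \<longlonglongrightarrow> a" if r: "r \<in> S n" for r
  proof -
    have "(T n ^^ t) f r = (\<Sum>k\<le>n. l k ^ t * F k r)" for t
    proof -
      have "(T n ^^ t) f = (\<Sum>k\<le>n. fun_scale (l k ^ t) (F k))"
        unfolding g(2) T_funpow_sum F_def[symmetric] by (intro sum.cong refl power) simp
      then have "(T n ^^ t) f r = (\<Sum>k\<le>n. fun_scale (l k ^ t) (F k)) r"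
        by (rule fun_cong)
      then show ?thesis
        by (simp add: sum_fun_apply fun_scale_def)
    qed
    moreover have "(\<lambda>t. l k ^ t * F k r) \<longlonglongrightarrow> (if k = 0 then a else 0)" if "k \<le> n" for k
    proof (cases "k = 0")
      case False
      then have "(\<lambda>t. l k ^ t * F k r) \<longlonglongrightarrow> 0 * F k r"
        using l[of k] that by (intro tendsto_mult LIMSEQ_realpow_zero tendsto_const) auto
      with False show ?thesis by simp
    qed (simp add: l_0 F_0 r)
    then have "(\<lambda>t. \<Sum>k\<le>n. l k ^ t * F k r) \<longlonglongrightarrow> (\<Sum>k\<le>n. if k = 0 then a else 0)"
      by (intro tendsto_sum) auto
    ultimately show ?thesis by (simp add: sum.delta)
  qed
  moreover have "(\<Sum>s\<in>S n. \<nu> s * f s) = a"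
    if \<nu>: "stationary_distribution (S n) (chain_mat S pu pd n) \<nu>" for \<nu>
  proof -
    have invariant: "(\<Sum>r\<in>S n. \<nu> r * T n q r) = (\<Sum>s\<in>S n. \<nu> s * q s)" for q
    proof -
      have "(\<Sum>r\<in>S n. \<nu> r * T n q r) = (\<Sum>r\<in>S n. \<Sum>s\<in>S n. \<nu> r * chain_mat S pu pd n r s * q s)"
        by (intro sum.cong) (simp_all add: mat_op_apply sum_distrib_left mult.assoc)
      also have "\<dots> = (\<Sum>s\<in>S n. (\<Sum>r\<in>S n. \<nu> r * chain_mat S pu pd n r s) * q s)"
        by (subst sum.swap) (simp add: sum_distrib_right)
      also have "\<dots> = (\<Sum>s\<in>S n. \<nu> s * q s)"
        using \<nu> by (intro sum.cong) (simp_all add: stationary_distribution_def)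
      finally show ?thesis .
    qed
    have "(\<Sum>s\<in>S n. \<nu> s * F k s) = (if k = 0 then a else 0)" if "k \<le> n" for k
    proof (cases "k = 0")
      case True
      have "(\<Sum>s\<in>S n. \<nu> s * F 0 s) = (\<Sum>s\<in>S n. \<nu> s) * a"
        by (simp add: F_0 sum_distrib_right)
      then show ?thesis
        using \<nu> True by (simp add: stationary_distribution_def)
    next
      case False
      have "T n (F k) = fun_scale (l k) (F k)"
        using power[OF that, of 1] by simp
      \<comment> \<open>Applying \<open>T n\<close> scales the integral by \<open>l k\<close> and
        also preserves it; as \<open>l k < 1\<close>, it is 0.\<close>
      then have "l k * (\<Sum>s\<in>S n. \<nu> s * F k s) = (\<Sum>s\<in>S n. \<nu> s * F k s)"
        using invariant[of "F k"] by (simp add: fun_scale_def sum_distrib_left mult.left_commute)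
      with False that l(2)[of k] show ?thesis by simp
    qed
    moreover have "(\<Sum>s\<in>S n. \<nu> s * f s) = (\<Sum>k\<le>n. \<Sum>s\<in>S n. \<nu> s * F k s)"
      unfolding g(2) F_def[symmetric] sum_fun_apply sum_distrib_left by (rule sum.swap)
    ultimately show ?thesis by (simp add: sum.delta)
  qed
  ultimately show ?thesis by blast
qed

lemma unique_stationary_up_prod:
  "unique_stationary_distribution (S n) (chain_mat S pu pd n) (up_prod S pu 0 n e)"
  unfolding unique_stationary_distribution_def
proof (intro conjI allI impI ballI stationary_up_prod)
  fix \<nu> s
  assume "stationary_distribution (S n) (chain_mat S pu pd n) \<nu>" and s: "s \<in> S n"
  \<comment> \<open>Both sides equal the number that \<open>T_funpow_limit\<close> attaches to the
    point mass at \<open>s\<close>.\<close>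
  then have "(\<Sum>t\<in>S n. \<nu> t * mat_id s t) = (\<Sum>t\<in>S n. up_prod S pu 0 n e t * mat_id s t)"
    using T_funpow_limit[OF mat_id_in_fun_space[OF s]] stationary_up_prod by metis
  then show "\<nu> s = up_prod S pu 0 n e s"
    using s by (simp only: sum_mat_id_right finite_S)
qed

text \<open>The limit in \<open>T_funpow_limit\<close> is the integral against any stationary
  distribution, in particular \<open>up_prod S pu 0 n e\<close>. Test functions are first cut down
  to \<open>S n\<close>.\<close>

lemma chain_law_converges:
  assumes "r \<in> S n"
  shows "converges_in_distribution (S n) (chain_law (S n) (chain_mat S pu pd n) r) (up_prod S pu 0 n e)"
  unfolding converges_in_distribution_def
proof
  fix f :: "'a \<Rightarrow> real"
  have restr_sum: "(\<Sum>s\<in>S n. \<mu> s * restr (S n) f s) = (\<Sum>s\<in>S n. \<mu> s * f s)" for \<mu> :: "'a \<Rightarrow> real"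
    by (intro sum.cong) (simp_all add: restr_def)
  obtain a where "(\<lambda>t. (T n ^^ t) (restr (S n) f) r) \<longlonglongrightarrow> a"
    "(\<Sum>s\<in>S n. up_prod S pu 0 n e s * restr (S n) f s) = a"
    using T_funpow_limit[OF restr_in_fun_space, of n f] assms stationary_up_prod by blast
  then show "(\<lambda>t. \<Sum>s\<in>S n. chain_law (S n) (chain_mat S pu pd n) r t s * f s)
      \<longlonglongrightarrow> (\<Sum>s\<in>S n. up_prod S pu 0 n e s * f s)"
    by (simp only: sum_chain_law[OF finite_S assms, symmetric] restr_sum)
qed

lemma ergodic_chain: "ergodic (S n) (chain_mat S pu pd n)"
  unfolding ergodic_def using unique_stationary_up_prod chain_law_converges by blast

end

theorem theorem1p1:
  fixes S :: "nat \<Rightarrow> 'a set" and e :: 'a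
    and pu pd :: "nat \<Rightarrow> 'a \<Rightarrow> 'a \<Rightarrow> real" and \<beta> :: "nat \<Rightarrow> real"
  assumes "\<And>n. finite (S n)"
    and "disjoint_family S"
    and "S 0 = {e}"
    and "\<And>n. stochastic (S n) (S (n + 1)) (pu n)"
    and "\<And>n. n \<ge> 1 \<Longrightarrow> stochastic (S n) (S (n - 1)) (pd n)"
    and "\<And>n. n \<ge> 1 \<Longrightarrow> 0 < \<beta> n \<and> \<beta> n < 1"
    and "\<And>n r s. n \<ge> 1 \<Longrightarrow> r \<in> S n \<Longrightarrow> s \<in> S n \<Longrightarrow>
           mat_mult (S (n + 1)) (pu n) (pd (n + 1)) r s =
             \<beta> n * mat_mult (S (n - 1)) (pd n) (pu (n - 1)) r s + (1 - \<beta> n) * mat_id r s"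
  defines "h \<equiv> h_fun S pu pd \<beta>"
    and "p \<equiv> chain_mat S pu pd"
  shows "(\<forall>n k. k \<le> n \<longrightarrow> (\<forall>s\<in>S k. \<forall>u\<in>S n.
            c_coeff \<beta> (int n) *
              (transition_op (S n) (p n) (restr (S n) (h s)) u - restr (S n) (h s) u) =
            - c_coeff \<beta> (int k - 1) * restr (S n) (h s) u))
       \<and> (\<forall>n. fun_space (S n) = fun_vs.span ((\<lambda>s. restr (S n) (h s)) ` (\<Union>k\<le>n. S k)))
       \<and> (\<forall>n k. k \<le> n \<longrightarrow>
            int (fun_vs.dim (fun_vs.span ((\<lambda>s. restr (S n) (h s)) ` S k))) =
              (if k = 0 then 1 else int (card (S k)) - int (card (S (k - 1)))))
       \<and> (\<forall>n. ergodic (S n) (p n)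
            \<and> unique_stationary_distribution (S n) (p n) (up_prod S pu 0 n e))"
proof -
  interpret up_down_chain S e pu pd \<beta>
  proof
    show "mat_mult (S (Suc (Suc n))) (pu (Suc n)) (pd (Suc (Suc n))) r s =
        \<beta> (Suc n) * mat_mult (S n) (pd (Suc n)) (pu n) r s + (1 - \<beta> (Suc n)) * mat_id r s"
      if "r \<in> S (Suc n)" "s \<in> S (Suc n)" for n r s
      using assms(7)[of "Suc n"] that by simp
  qed (use assms(1-4) assms(5,6)[of "Suc _"] in auto)
  have "c_coeff \<beta> (int n) * (transition_op (S n) (p n) (restr (S n) (h s)) u - restr (S n) (h s) u) =
      - c_coeff \<beta> (int k - 1) * restr (S n) (h s) u" if "k \<le> n" "s \<in> S k" for n k s u
  proof -
    \<comment> \<open>Undoes the index shift of \<open>c\<close>; then \<open>c (Suc n)\<close>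
      times \<open>(1 - c k / c (Suc n)) - 1\<close> is \<open>- c k\<close>.\<close>
    have c_eq: "c_coeff \<beta> (int n) = c (Suc n)" "c_coeff \<beta> (int k - 1) = c k"
      by (simp_all add: c_def)
    have "transition_op (S n) (p n) (restr (S n) (h s)) u = (1 - c k / c (Suc n)) * restr (S n) (h s) u"
      unfolding transition_op_eq_mat_op p_def h_def h_fun_eigenfunction[OF that] fun_scale_def ..
    then show ?thesis
      unfolding c_eq using c_pos[of n] by (simp add: field_simps)
  qed
  then show ?thesis
    using span_h_fun dim_span_h_fun ergodic_chain unique_stationary_up_prod
    unfolding h_def p_def by (intro conjI allI impI ballI) auto
qed

end
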